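(* Let $\xi_k$, $k\ge1$, be random variables from $D_{V,W}(\Omega)$ with $\|\xi_k\|>0$, where $\|\cdot\|=\|\cdot\|_{V,W}$. Let $f(x)=xV(W(x))$, $x>0$, let $f^{(-1)}$ be its inverse function, and put $$\alpha_k^*=V^{(-1)}\left(\frac{\|\xi_k\|^2}{f^{(-1)}(\|\xi_k\|^2)}\right).$$ If the series $\mu=\sum_{k=1}^\infty\alpha_k^*$ converges, then the series $\sum_{k=1}^\infty\xi_k$ converges in probability, and for $x\ge\mu$ $$P\left\{\left|\sum_{k=1}^\infty\xi_k\right|\ge x\right\}\le\sum_{k=1}^\infty W\left(\frac{\|\xi_k\|^2}{V\left(\frac{\alpha_k^*x}{\mu}\right)}\right)<\infty.$$
   Context: $W=\{W(x),x\in\mathbb R\}$ and $V=\{V(x),x\in\mathbb R\}$ are even functions, continuous and monotonically increasing for $x>0$, positive for $x\ne0$, such that: (1) there is $C>0$ with $W^{(-1)}(x+y)\le C(W^{(-1)}(x)+W^{(-1)}(y))$ for all $x,y>0$, where $W^{(-1)}$ is the inverse of $W$ on $x>0$; (2) there is a continuous function $Z=\{Z(x),x>0\}$, $0<Z(x)<\infty$, with $V(ax)\le Z(a)V(x)$ for all $a>0$, $x>0$; (3) $W(0)=0$. $V^{(-1)}$ is the inverse of $V$ for $x>0$. $D_{V,W}(\Omega)$ is the space of random variables $\xi$ with $\sup_{x\ge0}V(x)W^{(-1)}(P\{|\xi|>x\})<\infty$, with prenorm $\|\xi\|_{V,W}=\big(\sup_{x>0}V(x)W^{(-1)}(P\{|\xi|>x\})\big)^{1/2}$.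 *)

theory Defs
  imports "HOL-Probability.Probability"
begin

definition even_fun :: "(real \<Rightarrow> real) \<Rightarrow> bool" where
  "even_fun F \<longleftrightarrow> (\<forall>x. F (- x) = F x)"

text \<open>Strict monotonicity, since the inverse on the positive half-line has to exist.\<close>

definition gauge_fun :: "(real \<Rightarrow> real) \<Rightarrow> bool" where
  "gauge_fun F \<longleftrightarrow>
     even_fun F \<and> continuous_on {0<..} F \<and> strict_mono_on {0<..} F \<and> (\<forall>x. x \<noteq> 0 \<longrightarrow> 0 < F x)"

definition inv_pos :: "(real \<Rightarrow> real) \<Rightarrow> real \<Rightarrow> real" where
  "inv_pos F = inv_into {0<..} F"

text \<open>
  The inverse of \<open>W\<close> is also evaluated at the argument \<open>0\<close> (when a tail probability vanishes);
  as \<open>W 0 = 0\<close>, inverting on the closed half-line gives the value \<open>0\<close> there.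
\<close>

definition inv_nonneg :: "(real \<Rightarrow> real) \<Rightarrow> real \<Rightarrow> real" where
  "inv_nonneg F = inv_into {0..} F"

text \<open>
  The second conjunct says that the inverse of \<open>W\<close> is defined at every positive number, which the
  quasi-additivity inequality (required for all positive arguments) presupposes. It has to be
  spelled out because \<^const>\<open>inv_into\<close> is a total function.
\<close>

definition admissible_W :: "(real \<Rightarrow> real) \<Rightarrow> bool" where
  "admissible_W W \<longleftrightarrow>
     gauge_fun W \<and> W ` {0<..} = {0<..} \<and> W 0 = 0 \<and>
     (\<exists>C>0. \<forall>x>0. \<forall>y>0. inv_nonneg W (x + y) \<le> C * (inv_nonneg W x + inv_nonneg W y))"

definition admissible_V :: "(real \<Rightarrow> real) \<Rightarrow> bool" where
  "admissible_V V \<longleftrightarrow>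
     gauge_fun V \<and>
     (\<exists>Z. continuous_on {0<..} Z \<and> (\<forall>a>0. 0 < Z a) \<and>
          (\<forall>a>0. \<forall>x>0. V (a * x) \<le> Z a * V x))"

definition tail_prob :: "'a measure \<Rightarrow> ('a \<Rightarrow> real) \<Rightarrow> real \<Rightarrow> real" where
  "tail_prob M \<xi> x = measure M {\<omega> \<in> space M. \<bar>\<xi> \<omega>\<bar> > x}"

definition D_space :: "(real \<Rightarrow> real) \<Rightarrow> (real \<Rightarrow> real) \<Rightarrow> 'a measure \<Rightarrow> ('a \<Rightarrow> real) set" where
  "D_space V W M =
     {\<xi> \<in> borel_measurable M. bdd_above ((\<lambda>x. V x * inv_nonneg W (tail_prob M \<xi> x)) ` {0..})}"

text \<open>
  The supremum is a real one, hence meaningful only on \<open>D_space V W M\<close>, where it is finite.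
\<close>

definition prenorm :: "(real \<Rightarrow> real) \<Rightarrow> (real \<Rightarrow> real) \<Rightarrow> 'a measure \<Rightarrow> ('a \<Rightarrow> real) \<Rightarrow> real" where
  "prenorm V W M \<xi> = sqrt (SUP x\<in>{0<..}. V x * inv_nonneg W (tail_prob M \<xi> x))"

definition f_fun :: "(real \<Rightarrow> real) \<Rightarrow> (real \<Rightarrow> real) \<Rightarrow> real \<Rightarrow> real" where
  "f_fun V W x = x * V (W x)"

definition alpha_star :: "(real \<Rightarrow> real) \<Rightarrow> (real \<Rightarrow> real) \<Rightarrow> 'a measure \<Rightarrow> ('a \<Rightarrow> real) \<Rightarrow> real" where
  "alpha_star V W M \<xi> =
     inv_pos V ((prenorm V W M \<xi>)\<^sup>2 / inv_pos (f_fun V W) ((prenorm V W M \<xi>)\<^sup>2))"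

definition series_converges_in_prob ::
  "'a measure \<Rightarrow> (nat \<Rightarrow> 'a \<Rightarrow> real) \<Rightarrow> ('a \<Rightarrow> real) \<Rightarrow> bool" where
  "series_converges_in_prob M \<xi> S \<longleftrightarrow>
     S \<in> borel_measurable M \<and>
     (\<forall>\<epsilon>>0. (\<lambda>n. measure M {\<omega> \<in> space M. \<bar>(\<Sum>k<n. \<xi> k \<omega>) - S \<omega>\<bar> > \<epsilon>}) \<longlonglongrightarrow> 0)"

end

theory Submission
  imports Defs
begin

text \<open>
  Let \<open>c = \<parallel>\<xi>\<parallel>\<^sup>2\<close>.  Unfolding the supremum and using continuity gives the tail
  estimate \<open>P(\<bar>\<xi>\<bar> \<ge> t) \<le> W (c / V t)\<close> for \<open>t > 0\<close>.  The number \<open>\<alpha>\<^sup>*\<close> is the level at which this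
  estimate returns the level itself: with \<open>y = f\<^sup>-\<^sup>1(c)\<close>, that is \<open>y V(W y) = c\<close>, one gets
  \<open>\<alpha>\<^sup>* = V\<^sup>-\<^sup>1(c / y) = W y\<close>, hence \<open>c / V \<alpha>\<^sup>* = y\<close> and \<open>W (c / V \<alpha>\<^sup>*) = \<alpha>\<^sup>*\<close>
  (\<open>alpha_star_fixed_point\<close>).

  Therefore \<open>P(\<bar>\<xi>\<^sub>k\<bar> \<ge> \<alpha>\<^sub>k) \<le> \<alpha>\<^sub>k\<close>, and convergence of \<open>\<Sum>\<alpha>\<^sub>k\<close> is used twice: as convergence
  of the probabilities it gives, by Borel-Cantelli, \<open>\<bar>\<xi>\<^sub>k\<bar> < \<alpha>\<^sub>k\<close> for all large \<open>k\<close> almost surely,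
  and as convergence of the levels it then makes \<open>\<Sum>\<xi>\<^sub>k\<close> absolutely convergent almost surely
  (\<open>AE_summable_of_tail_levels\<close>).  Almost sure convergence implies convergence in probability, and
  limits in probability are almost surely unique, so every limit \<open>S\<close> is almost surely the
  pointwise sum.

  For the estimate, distribute \<open>x\<close> over the summands in proportion to \<open>\<alpha>\<^sub>k\<close>: as
  \<open>\<Sum> \<alpha>\<^sub>k x / \<mu> = x\<close>, a sum of modulus at least \<open>x\<close> needs some \<open>k\<close> with
  \<open>\<bar>\<xi>\<^sub>k\<bar> \<ge> \<alpha>\<^sub>k x / \<mu>\<close>, and countable subadditivity together with the tail estimate finishes.  For
  \<open>x \<ge> \<mu>\<close> the resulting terms are at most \<open>W (c\<^sub>k / V \<alpha>\<^sub>k) = \<alpha>\<^sub>k\<close>, so their sum is finite.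
\<close>

section \<open>Gauge functions and their inverses\<close>

lemma gauge_fun_less:
  assumes "gauge_fun F" "0 < x" "x < y"
  shows "F x < F y"
  using assms by (auto simp: gauge_fun_def strict_mono_on_def)

lemma gauge_fun_le:
  assumes "gauge_fun F" "0 < x" "x \<le> y"
  shows "F x \<le> F y"
  using gauge_fun_less[OF assms(1,2), of y] assms(3) by (cases "x = y") auto

lemma gauge_fun_pos: "gauge_fun F \<Longrightarrow> 0 < x \<Longrightarrow> 0 < F x"
  by (auto simp: gauge_fun_def)

lemma gauge_fun_isCont:
  assumes "gauge_fun F" "0 < x"
  shows "isCont F x"
  using assms continuous_on_eq_continuous_at[OF open_greaterThan, of 0 F]
  by (auto simp: gauge_fun_def)

lemma strict_mono_on_inj_pos:
  assumes "\<And>x y. 0 < x \<Longrightarrow> x < y \<Longrightarrow> F x < F (y::real)"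
  shows "inj_on (F :: real \<Rightarrow> real) {0<..}"
  by (rule linorder_inj_onI) (use assms in force)+

lemma inv_pos_gauge_fun:
  assumes "gauge_fun F" "0 < x"
  shows "inv_pos F (F x) = x"
  unfolding inv_pos_def
  using assms(2)
  by (intro inv_into_f_f strict_mono_on_inj_pos gauge_fun_less[OF assms(1)]) auto

lemma admissible_W_gauge: "admissible_W W \<Longrightarrow> gauge_fun W"
  by (simp add: admissible_W_def)

lemma admissible_V_gauge: "admissible_V V \<Longrightarrow> gauge_fun V"
  by (simp add: admissible_V_def)

lemma admissible_W_less:
  assumes "admissible_W W" "0 \<le> x" "x < y"
  shows "W x < W y"
proof (cases "x = 0")
  case True
  then show ?thesis
    using assms gauge_fun_pos[OF admissible_W_gauge, of W y] by (auto simp: admissible_W_def)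
next
  case False
  then show ?thesis
    using assms gauge_fun_less[OF admissible_W_gauge] by auto
qed

lemma admissible_W_le: "admissible_W W \<Longrightarrow> 0 \<le> x \<Longrightarrow> x \<le> y \<Longrightarrow> W x \<le> W y"
  using admissible_W_less[of W x y] by (cases "x = y") auto

lemma inv_nonneg_admissible_W:
  assumes "admissible_W W" "0 \<le> p"
  shows "0 \<le> inv_nonneg W p" "W (inv_nonneg W p) = p"
proof -
  have "p \<in> W ` {0..}"
  proof (cases "p = 0")
    case True
    then show ?thesis
      using assms by (intro image_eqI[of _ _ 0]) (auto simp: admissible_W_def)
  next
    case False
    then have "p \<in> W ` {0<..}"
      using assms by (auto simp: admissible_W_def)
    then show ?thesis by auto
  qed
  then show "0 \<le> inv_nonneg W p" "W (inv_nonneg W p) = p"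
    unfolding inv_nonneg_def using inv_into_into[of p W "{0..}"] f_inv_into_f[of p W "{0..}"]
    by auto
qed

section \<open>The level at which the tail estimate reproduces itself\<close>

lemma f_fun_less:
  assumes "gauge_fun V" "gauge_fun W" "0 < x" "x < y"
  shows "f_fun V W x < f_fun V W y"
proof -
  have "0 < W x" "V (W x) < V (W y)"
    using assms by (auto intro: gauge_fun_pos gauge_fun_less[OF assms(1)] gauge_fun_less[OF assms(2)])
  then show ?thesis
    unfolding f_fun_def
    using assms gauge_fun_pos[OF assms(1), of "W x"] by (intro mult_strict_mono) auto
qed

text \<open>
  Even when \<open>V\<close> has bounded range, so that \<open>V\<^sup>-\<^sup>1\<close> is only defined on an interval, \<open>f\<close> attains every
  positive value: near the origin the factor \<open>V (W x)\<close> stays bounded, and for \<open>x \<ge> 1\<close> it is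
  bounded below by \<open>V (W 1) > 0\<close>.
\<close>

lemma f_fun_surj_pos:
  assumes V: "gauge_fun V" and W: "gauge_fun W" and c: "0 < c"
  obtains y where "0 < y" "f_fun V W y = c"
proof -
  define v where "v = V (W 1)"
  define a where "a = min 1 (c / v)"
  define b where "b = max 1 (c / v)"
  have v: "0 < v"
    unfolding v_def by (intro gauge_fun_pos[OF V] gauge_fun_pos[OF W]) simp
  have a: "0 < a" "a \<le> 1" and b: "1 \<le> b" and ac: "a * v \<le> c" and bc: "c \<le> b * v"
    using v c by (auto simp: a_def b_def min_def max_def field_simps)
  have "f_fun V W a \<le> a * v"
    unfolding f_fun_def v_def
    using a by (intro mult_left_mono gauge_fun_le[OF V] gauge_fun_le[OF W] gauge_fun_pos[OF W]) auto
  moreover have "b * v \<le> f_fun V W b"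
    unfolding f_fun_def v_def
    using b by (intro mult_left_mono gauge_fun_le[OF V] gauge_fun_le[OF W] gauge_fun_pos[OF W]) auto
  moreover have "\<forall>x. a \<le> x \<and> x \<le> b \<longrightarrow> isCont (f_fun V W) x"
  proof (intro allI impI)
    fix x assume "a \<le> x \<and> x \<le> b"
    then have "0 < x" using a by linarith
    then have "isCont W x" "isCont V (W x)"
      by (auto intro!: gauge_fun_isCont[OF V] gauge_fun_isCont[OF W] gauge_fun_pos[OF W])
    then have "isCont (\<lambda>x. V (W x)) x"
      by (rule isCont_o2)
    then show "isCont (f_fun V W) x"
      unfolding f_fun_def[abs_def] by (intro isCont_mult continuous_ident)
  qed
  ultimately obtain y where "a \<le> y" "f_fun V W y = c"
    using IVT[of "f_fun V W" a c b] a b ac bc by auto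
  then show ?thesis
    using a(1) by (intro that[of y]) auto
qed

lemma alpha_star_fixed_point:
  assumes V: "gauge_fun V" and W: "gauge_fun W" and c: "0 < prenorm V W M \<xi>"
  shows "0 < alpha_star V W M \<xi>"
    and "W ((prenorm V W M \<xi>)\<^sup>2 / V (alpha_star V W M \<xi>)) = alpha_star V W M \<xi>"
proof -
  obtain y where y: "0 < y" "f_fun V W y = (prenorm V W M \<xi>)\<^sup>2"
    using f_fun_surj_pos[OF V W, of "(prenorm V W M \<xi>)\<^sup>2"] c by auto
  have inv: "inv_pos (f_fun V W) (f_fun V W y) = y"
    unfolding inv_pos_def
    using y by (intro inv_into_f_f strict_mono_on_inj_pos f_fun_less[OF V W]) auto
  have Wy: "0 < W y"
    using gauge_fun_pos[OF W] y by simp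
  have "f_fun V W y / y = V (W y)"
    using y(1) by (simp add: f_fun_def)
  then have alpha: "alpha_star V W M \<xi> = W y"
    unfolding alpha_star_def y(2)[symmetric] inv using inv_pos_gauge_fun[OF V Wy] by simp
  show "0 < alpha_star V W M \<xi>"
    using alpha Wy by simp
  show "W ((prenorm V W M \<xi>)\<^sup>2 / V (alpha_star V W M \<xi>)) = alpha_star V W M \<xi>"
    unfolding alpha y(2)[symmetric] f_fun_def using gauge_fun_pos[OF V Wy] by simp
qed

section \<open>The tail estimate\<close>

lemma tail_prob_le:
  assumes W: "admissible_W W" and V: "gauge_fun V"
    and D: "\<xi> \<in> D_space V W M" and c: "0 < prenorm V W M \<xi>" and x: "0 < x"
  shows "tail_prob M \<xi> x \<le> W ((prenorm V W M \<xi>)\<^sup>2 / V x)"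
proof -
  define g where "g = (\<lambda>x. V x * inv_nonneg W (tail_prob M \<xi> x))"
  have tail_nonneg: "0 \<le> tail_prob M \<xi> x"
    by (simp add: tail_prob_def)
  have "bdd_above (g ` {0<..})"
    using D by (auto simp: D_space_def g_def intro: bdd_above_mono)
  then have "g x \<le> (SUP x\<in>{0<..}. g x)"
    using x by (intro cSUP_upper) auto
  also have "\<dots> = (prenorm V W M \<xi>)\<^sup>2"
    using c by (simp add: prenorm_def g_def)
  finally have "inv_nonneg W (tail_prob M \<xi> x) \<le> (prenorm V W M \<xi>)\<^sup>2 / V x"
    using gauge_fun_pos[OF V x] by (simp add: g_def field_simps)
  then have "W (inv_nonneg W (tail_prob M \<xi> x)) \<le> W ((prenorm V W M \<xi>)\<^sup>2 / V x)"
    by (rule admissible_W_le[OF W inv_nonneg_admissible_W(1)[OF W tail_nonneg]])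
  then show ?thesis
    by (simp add: inv_nonneg_admissible_W[OF W tail_nonneg])
qed

text \<open>
  The prenorm controls the strict tails, whereas the theorem is about \<open>\<ge>\<close>.  Continuity of \<open>V\<close>
  and \<open>W\<close> allows the level of a strict tail to increase to \<open>t\<close>.
\<close>

lemma (in prob_space) closed_tail_le:
  assumes W: "admissible_W W" and V: "gauge_fun V"
    and D: "\<xi> \<in> D_space V W M" and c: "0 < prenorm V W M \<xi>" and t: "0 < t"
  shows "prob {\<omega> \<in> space M. t \<le> \<bar>\<xi> \<omega>\<bar>} \<le> W ((prenorm V W M \<xi>)\<^sup>2 / V t)"
proof (rule tendsto_lowerbound)
  have [measurable]: "\<xi> \<in> borel_measurable M"
    using D by (simp add: D_space_def)
  have Vt: "0 < V t"
    by (rule gauge_fun_pos[OF V t])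
  have "isCont W ((prenorm V W M \<xi>)\<^sup>2 / V t)"
    using c Vt by (intro gauge_fun_isCont[OF admissible_W_gauge[OF W]]) simp
  then have "isCont (\<lambda>s. W ((prenorm V W M \<xi>)\<^sup>2 / V s)) t"
    by (rule isCont_o2[rotated]) (use Vt in \<open>auto intro!: continuous_intros gauge_fun_isCont[OF V t]\<close>)
  then show "((\<lambda>s. W ((prenorm V W M \<xi>)\<^sup>2 / V s)) \<longlongrightarrow> W ((prenorm V W M \<xi>)\<^sup>2 / V t)) (at_left t)"
    by (auto simp: isCont_def intro: filterlim_mono at_le)
  have "\<forall>\<^sub>F s in at_left t. s \<in> {0<..<t}"
    using t by (rule eventually_at_leftI[rotated]) auto
  then show "\<forall>\<^sub>F s in at_left t.
      prob {\<omega> \<in> space M. t \<le> \<bar>\<xi> \<omega>\<bar>} \<le> W ((prenorm V W M \<xi>)\<^sup>2 / V s)"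
  proof eventually_elim
    case (elim s)
    have "prob {\<omega> \<in> space M. t \<le> \<bar>\<xi> \<omega>\<bar>} \<le> tail_prob M \<xi> s"
      unfolding tail_prob_def using elim by (intro finite_measure_mono) auto
    also have "\<dots> \<le> W ((prenorm V W M \<xi>)\<^sup>2 / V s)"
      using elim by (intro tail_prob_le W V D c) auto
    finally show ?case .
  qed
qed simp

section \<open>Almost sure convergence and convergence in probability\<close>

text \<open>Borel-Cantelli, applied to the events that a summand exceeds its level.\<close>

lemma (in prob_space) AE_summable_of_tail_levels:
  fixes \<xi> :: "nat \<Rightarrow> 'a \<Rightarrow> real"
  assumes [measurable]: "\<And>k. \<xi> k \<in> borel_measurable M"
    and a: "summable a"
    and prob: "\<And>k. prob {\<omega> \<in> space M. a k \<le> \<bar>\<xi> k \<omega>\<bar>} \<le> b k" and b: "summable b"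
  shows "AE \<omega> in M. summable (\<lambda>k. \<bar>\<xi> k \<omega>\<bar>)"
proof -
  have "summable (\<lambda>k. prob {\<omega> \<in> space M. a k \<le> \<bar>\<xi> k \<omega>\<bar>})"
    by (rule summable_comparison_test'[OF b, of 0]) (use prob in simp)
  then have "AE \<omega> in M. \<forall>\<^sub>F k in sequentially. \<omega> \<in> space M - {\<omega> \<in> space M. a k \<le> \<bar>\<xi> k \<omega>\<bar>}"
    by (intro borel_cantelli_AE1) (auto simp: emeasure_eq_measure)
  then show ?thesis
  proof eventually_elim
    case (elim \<omega>)
    then have "\<forall>\<^sub>F k in sequentially. norm \<bar>\<xi> k \<omega>\<bar> \<le> a k"
      by eventually_elim auto
    then show ?case
      by (rule summable_comparison_test_ev[OF _ a])
  qed
qed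

text \<open>
  The probabilities are integrals of indicators that vanish eventually, so dominated convergence
  applies.
\<close>

lemma (in prob_space) AE_sums_imp_series_converges_in_prob:
  fixes \<xi> :: "nat \<Rightarrow> 'a \<Rightarrow> real"
  assumes [measurable]: "\<And>k. \<xi> k \<in> borel_measurable M" "S \<in> borel_measurable M"
    and lim: "AE \<omega> in M. (\<lambda>k. \<xi> k \<omega>) sums S \<omega>"
  shows "series_converges_in_prob M \<xi> S"
  unfolding series_converges_in_prob_def
proof (intro conjI allI impI)
  fix \<epsilon> :: real assume \<epsilon>: "\<epsilon> > 0"
  define A where "A = (\<lambda>n. {\<omega> \<in> space M. \<bar>(\<Sum>k<n. \<xi> k \<omega>) - S \<omega>\<bar> > \<epsilon>})"
  have [measurable]: "A n \<in> sets M" for n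
    unfolding A_def by measurable
  have "(\<lambda>n. \<integral>\<omega>. indicat_real (A n) \<omega> \<partial>M) \<longlonglongrightarrow> (\<integral>\<omega>. 0 \<partial>M)"
  proof (rule integral_dominated_convergence[where w = "\<lambda>_. 1"])
    show "AE \<omega> in M. (\<lambda>n. indicat_real (A n) \<omega>) \<longlonglongrightarrow> 0"
      using lim
    proof eventually_elim
      case (elim \<omega>)
      have "\<forall>\<^sub>F n in sequentially. dist (\<Sum>k<n. \<xi> k \<omega>) (S \<omega>) < \<epsilon>"
        using elim \<epsilon> unfolding sums_def by (rule tendstoD)
      then have "\<forall>\<^sub>F n in sequentially. indicat_real (A n) \<omega> = 0"
        by eventually_elim (auto simp: A_def dist_real_def indicator_def)
      then show ?case
        by (rule tendsto_eventually)
    qed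
  qed (auto simp: indicator_def)
  then show "(\<lambda>n. prob {\<omega> \<in> space M. \<bar>(\<Sum>k<n. \<xi> k \<omega>) - S \<omega>\<bar> > \<epsilon>}) \<longlonglongrightarrow> 0"
    by (simp add: A_def)
qed simp

text \<open>
  If two limits differ by more than \<open>2\<epsilon>\<close>, every partial sum is more than \<open>\<epsilon>\<close> away from one of
  them, and both of these events have probabilities tending to zero.
\<close>

lemma (in prob_space) series_converges_in_prob_unique:
  fixes \<xi> :: "nat \<Rightarrow> 'a \<Rightarrow> real"
  assumes [measurable]: "\<And>k. \<xi> k \<in> borel_measurable M"
    and S: "series_converges_in_prob M \<xi> S" and T: "series_converges_in_prob M \<xi> T"
  shows "AE \<omega> in M. S \<omega> = T \<omega>"
proof -
  have [measurable]: "S \<in> borel_measurable M" "T \<in> borel_measurable M"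
    using S T by (auto simp: series_converges_in_prob_def)
  have "AE \<omega> in M. \<bar>S \<omega> - T \<omega>\<bar> \<le> 2 / real (Suc m)" for m
  proof -
    define \<epsilon> where "\<epsilon> = 1 / real (Suc m)"
    define A where "A = (\<lambda>R n. {\<omega> \<in> space M. \<bar>(\<Sum>k<n. \<xi> k \<omega>) - R \<omega>\<bar> > \<epsilon>})"
    define B where "B = {\<omega> \<in> space M. \<bar>S \<omega> - T \<omega>\<bar> > 2 * \<epsilon>}"
    have [measurable]: "B \<in> sets M"
      unfolding B_def by measurable
    have [measurable]: "A R n \<in> sets M" if [measurable]: "R \<in> borel_measurable M" for R n
      unfolding A_def by measurable
    have "\<epsilon> > 0"
      by (simp add: \<epsilon>_def)
    then have "(\<lambda>n. prob (A S n) + prob (A T n)) \<longlonglongrightarrow> 0 + 0"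
      using S T unfolding A_def series_converges_in_prob_def by (intro tendsto_add) auto
    moreover have "prob B \<le> prob (A S n) + prob (A T n)" for n
    proof -
      have "prob B \<le> prob (A S n \<union> A T n)"
        by (intro finite_measure_mono) (auto simp: A_def B_def)
      also have "\<dots> \<le> prob (A S n) + prob (A T n)"
        by (rule measure_Un_le) measurable
      finally show ?thesis .
    qed
    ultimately have "prob B \<le> 0"
      using LIMSEQ_le_const[of "\<lambda>n. prob (A S n) + prob (A T n)" 0 "prob B"] by simp
    then have "prob B = 0"
      using measure_nonneg[of M B] by linarith
    then have "AE \<omega> in M. \<omega> \<notin> B"
      by (subst prob_eq_0[symmetric]) auto
    then show ?thesis
      by (rule AE_mp) (auto simp: B_def \<epsilon>_def not_less)
  qed
  then have "AE \<omega> in M. \<forall>m. \<bar>S \<omega> - T \<omega>\<bar> \<le> 2 / real (Suc m)"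
    by (simp add: AE_all_countable)
  then show ?thesis
  proof eventually_elim
    case (elim \<omega>)
    have "(\<lambda>m. 2 / real (Suc m)) \<longlonglongrightarrow> 0"
      by (rule LIMSEQ_Suc[OF lim_const_over_n])
    then have "\<bar>S \<omega> - T \<omega>\<bar> \<le> 0"
      by (rule LIMSEQ_le_const) (use elim in auto)
    then show ?case by simp
  qed
qed

text \<open>
  If every summand stays strictly below its share \<open>a\<^sub>k\<close> of the threshold \<open>x\<close>, then so does the sum;
  strictness survives the passage to the limit because the differences \<open>a\<^sub>k - \<bar>u\<^sub>k\<bar>\<close> form a
  convergent series of positive terms.
\<close>

lemma abs_suminf_less:
  fixes u a :: "nat \<Rightarrow> real"
  assumes a: "a sums x" and less: "\<And>k. \<bar>u k\<bar> < a k"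
  shows "\<bar>\<Sum>k. u k\<bar> < x"
proof -
  have u: "summable (\<lambda>k. \<bar>u k\<bar>)"
    by (rule summable_comparison_test'[OF sums_summable[OF a], of 0])
      (use less in \<open>simp add: less_imp_le\<close>)
  have "0 < (\<Sum>k. a k - \<bar>u k\<bar>)"
    using less by (intro suminf_pos summable_diff u sums_summable[OF a]) auto
  then have "(\<Sum>k. \<bar>u k\<bar>) < x"
    using suminf_diff[OF sums_summable[OF a] u] sums_unique[OF a] by simp
  then show ?thesis
    using summable_rabs[OF u] by linarith
qed

section \<open>The series estimate\<close>

text \<open>
  A sum of modulus at least \<open>x\<close> needs a summand that reaches its share \<open>a\<^sub>k\<close> of the threshold, so a
  union bound over \<open>k\<close> suffices.
\<close>

lemma (in prob_space) prob_abs_series_ge_le: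
  fixes \<xi> :: "nat \<Rightarrow> 'a \<Rightarrow> real"
  assumes [measurable]: "\<And>k. \<xi> k \<in> borel_measurable M" "S \<in> borel_measurable M"
    and S: "AE \<omega> in M. S \<omega> = (\<Sum>k. \<xi> k \<omega>)"
    and a: "a sums x"
    and prob: "\<And>k. prob {\<omega> \<in> space M. a k \<le> \<bar>\<xi> k \<omega>\<bar>} \<le> b k" and b: "summable b"
  shows "prob {\<omega> \<in> space M. x \<le> \<bar>S \<omega>\<bar>} \<le> (\<Sum>k. b k)"
proof -
  define E where "E = (\<lambda>k. {\<omega> \<in> space M. a k \<le> \<bar>\<xi> k \<omega>\<bar>})"
  have [measurable]: "E k \<in> sets M" for k
    unfolding E_def by measurable
  have E: "summable (\<lambda>k. prob (E k))"
    by (rule summable_comparison_test'[OF b, of 0]) (use prob in \<open>simp add: E_def\<close>)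
  have "AE \<omega> in M. \<omega> \<in> {\<omega> \<in> space M. x \<le> \<bar>S \<omega>\<bar>} \<longrightarrow> \<omega> \<in> (\<Union>k. E k)"
    using S
  proof eventually_elim
    case (elim \<omega>)
    show ?case
      using abs_suminf_less[OF a, of "\<lambda>k. \<xi> k \<omega>"] elim by (force simp: E_def not_le)
  qed
  then have "prob {\<omega> \<in> space M. x \<le> \<bar>S \<omega>\<bar>} \<le> prob (\<Union>k. E k)"
    by (rule finite_measure_mono_AE) measurable
  also have "\<dots> \<le> (\<Sum>k. prob (E k))"
    by (rule finite_measure_subadditive_countably[OF _ E]) auto
  also have "\<dots> \<le> (\<Sum>k. b k)"
    using prob by (intro suminf_le E b) (auto simp: E_def)
  finally show ?thesis .
qed

theorem theorem6p3:
  fixes M :: "'a measure" and V W :: "real \<Rightarrow> real"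
    and \<xi> :: "nat \<Rightarrow> 'a \<Rightarrow> real" and \<alpha> :: "nat \<Rightarrow> real" and \<mu> :: real
  assumes "prob_space M"
    and "admissible_W W"
    and "admissible_V V"
    and "\<And>k. \<xi> k \<in> D_space V W M"
    and "\<And>k. prenorm V W M (\<xi> k) > 0"
    and "\<And>k. \<alpha> k = alpha_star V W M (\<xi> k)"
    and "\<alpha> sums \<mu>"
  shows "(\<exists>S. series_converges_in_prob M \<xi> S) \<and>
         (\<forall>S. series_converges_in_prob M \<xi> S \<longrightarrow>
           (\<forall>x\<ge>\<mu>.
              summable (\<lambda>k. W ((prenorm V W M (\<xi> k))\<^sup>2 / V (\<alpha> k * x / \<mu>))) \<and>
              measure M {\<omega> \<in> space M. \<bar>S \<omega>\<bar> \<ge> x}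
                \<le> (\<Sum>k. W ((prenorm V W M (\<xi> k))\<^sup>2 / V (\<alpha> k * x / \<mu>)))))"
proof -
  interpret prob_space M by fact
  note W = \<open>admissible_W W\<close> and D = assms(4) and norm_pos = assms(5)
  have V: "gauge_fun V" and W': "gauge_fun W"
    using assms(2,3) by (auto intro: admissible_V_gauge admissible_W_gauge)
  define c where "c = (\<lambda>k. (prenorm V W M (\<xi> k))\<^sup>2)"
  have c: "0 < c k" for k
    using norm_pos[of k] by (simp add: c_def)
  have meas [measurable]: "\<xi> k \<in> borel_measurable M" for k
    using D[of k] by (simp add: D_space_def)
  have \<alpha>: "0 < \<alpha> k" "W (c k / V (\<alpha> k)) = \<alpha> k" for k
    using alpha_star_fixed_point[OF V W' norm_pos[of k]] by (simp_all add: assms(6) c_def)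
  have tail: "prob {\<omega> \<in> space M. t \<le> \<bar>\<xi> k \<omega>\<bar>} \<le> W (c k / V t)" if "0 < t" for k t
    unfolding c_def by (rule closed_tail_le[OF W V D norm_pos that])
  have summable_\<alpha>: "summable \<alpha>"
    using assms(7) by (rule sums_summable)
  have \<mu>: "0 < \<mu>"
    using suminf_pos[OF summable_\<alpha> \<alpha>(1)] sums_unique[OF assms(7)] by simp
  define T where "T = (\<lambda>\<omega>. \<Sum>k. \<xi> k \<omega>)"
  have [measurable]: "T \<in> borel_measurable M"
    unfolding T_def by measurable
  have "prob {\<omega> \<in> space M. \<alpha> k \<le> \<bar>\<xi> k \<omega>\<bar>} \<le> \<alpha> k" for k
    using tail[OF \<alpha>(1)[of k], of k] by (simp only: \<alpha>(2))
  then have "AE \<omega> in M. summable (\<lambda>k. \<bar>\<xi> k \<omega>\<bar>)"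
    by (intro AE_summable_of_tail_levels[of \<xi> \<alpha> \<alpha>] meas summable_\<alpha>)
  then have "AE \<omega> in M. (\<lambda>k. \<xi> k \<omega>) sums T \<omega>"
    by eventually_elim (auto simp: T_def intro: summable_sums summable_rabs_cancel)
  then have T: "series_converges_in_prob M \<xi> T"
    by (intro AE_sums_imp_series_converges_in_prob) auto
  have bound: "summable (\<lambda>k. W (c k / V (\<alpha> k * x / \<mu>))) \<and>
      prob {\<omega> \<in> space M. \<bar>S \<omega>\<bar> \<ge> x} \<le> (\<Sum>k. W (c k / V (\<alpha> k * x / \<mu>)))"
    if S: "series_converges_in_prob M \<xi> S" and x: "\<mu> \<le> x" for S x
  proof
    have share: "\<alpha> k \<le> \<alpha> k * x / \<mu>" "0 < \<alpha> k * x / \<mu>" for k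
      using \<alpha>(1)[of k] \<mu> x by (auto simp: field_simps)
    have "0 < W (c k / V (\<alpha> k * x / \<mu>))" for k
      using c[of k] by (intro gauge_fun_pos[OF W'] divide_pos_pos gauge_fun_pos[OF V] share)
    moreover have "W (c k / V (\<alpha> k * x / \<mu>)) \<le> \<alpha> k" for k
    proof -
      have "c k / V (\<alpha> k * x / \<mu>) \<le> c k / V (\<alpha> k)"
        using c[of k] share[of k] \<alpha>(1)[of k]
        by (intro divide_left_mono gauge_fun_le[OF V] mult_pos_pos gauge_fun_pos[OF V]) auto
      moreover have "0 < c k / V (\<alpha> k * x / \<mu>)"
        using c[of k] by (intro divide_pos_pos gauge_fun_pos[OF V] share)
      ultimately have "W (c k / V (\<alpha> k * x / \<mu>)) \<le> W (c k / V (\<alpha> k))"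
        by (intro gauge_fun_le[OF W'])
      then show ?thesis
        by (simp only: \<alpha>(2))
    qed
    ultimately show sum: "summable (\<lambda>k. W (c k / V (\<alpha> k * x / \<mu>)))"
      by (intro summable_comparison_test'[OF summable_\<alpha>, of 0]) (simp add: less_imp_le)
    have "AE \<omega> in M. S \<omega> = (\<Sum>k. \<xi> k \<omega>)"
      using series_converges_in_prob_unique[OF meas S T] by (simp add: T_def)
    moreover have "(\<lambda>k. \<alpha> k * x / \<mu>) sums x"
      using sums_mult2[OF assms(7), of "x / \<mu>"] \<mu> by simp
    moreover have "S \<in> borel_measurable M"
      using S by (simp add: series_converges_in_prob_def)
    ultimately show "prob {\<omega> \<in> space M. \<bar>S \<omega>\<bar> \<ge> x} \<le> (\<Sum>k. W (c k / V (\<alpha> k * x / \<mu>)))"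
      by (intro prob_abs_series_ge_le[of \<xi> S "\<lambda>k. \<alpha> k * x / \<mu>" x] meas tail share sum)
  qed
  show ?thesis
  proof (rule conjI; (intro allI impI)?)
    show "\<exists>S. series_converges_in_prob M \<xi> S"
      using T by (rule exI[where x = T])
  next
    fix S x assume "series_converges_in_prob M \<xi> S" "\<mu> \<le> x"
    then show "summable (\<lambda>k. W ((prenorm V W M (\<xi> k))\<^sup>2 / V (\<alpha> k * x / \<mu>))) \<and>
        prob {\<omega> \<in> space M. x \<le> \<bar>S \<omega>\<bar>}
          \<le> (\<Sum>k. W ((prenorm V W M (\<xi> k))\<^sup>2 / V (\<alpha> k * x / \<mu>)))"
      by (rule bound[unfolded c_def])
  qed
qed

end
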